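(* Let $\mathbf A$ be a finite Boolean algebra with atoms $\alpha_1,\ldots,\alpha_n$. The set of atoms of the Boolean algebra $\mathcal{T}(\mathbf A)$ is exactly $\{[\omega_{\langle\beta\rangle}] : \langle\beta\rangle=\langle\beta_1,\ldots,\beta_{n-1}\rangle$ a sequence of pairwise different atoms of $\mathbf A\}$, where $\omega_{\langle\beta\rangle}=(\beta_1\mid\top)\wedge(\beta_2\mid\overline{\beta_1})\wedge\cdots\wedge(\beta_{n-1}\mid\overline{\beta_1}\wedge\cdots\wedge\overline{\beta_{n-2}})$.
   Context: $\mathbf A=(A,\wedge,\vee,\neg,\bot,\top)$ is a finite Boolean algebra; $ab=a\wedge b$, $\bar a=\neg a$, $A'=A\setminus\{\bot\}$. $\Omega$ is the set of Boolean homomorphisms $w:\mathbf A\to\{0,1\}$ (identified with atoms); $w\models a$ means $w(a)=1$. A basic conditional is a pair $(a\mid b)$, $a\in A$, $b\in A'$. $\mathbb{T}(A)$ is the set of terms built from basic conditionals (as variables) and constants $0,1$ using $\neg,\wedge,\vee$. $\mathbf b(t)$ is the disjunction of antecedents of basic conditionals occurring in $t$ ($\top$ if $t\in\{0,1\}$). The $w$-reduct $t^w$: replace each occurring $(a_i\mid b_i)$ by $1$ if $w\models a_ib_i$, by $0$ if $w\models\bar a_ib_i$ (unchanged if $w\models\bar b_i$), then apply $\neg1:=0$, $\neg0:=1$, $r\wedge1=1\wedge r:=r$, $r\wedge0=0\wedge r:=0$, $r\vee1=1\vee r:=1$, $r\vee0=0\vee r:=r$ until no rule applies. A conditional probability on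 $A\times A'$ is $P:A\times A'\to[0,1]$ with $P(\cdot\mid b)$ a finitely additive probability for each $b\in A'$, $P(b\mid b)=1$, $P(ab\mid c)=P(a\mid bc)P(b\mid c)$; $\mathbb P(X\mid b)=\sum_wX(w)P(w\mid b)$. Given $P$, $X_t:\Omega\to[0,1]$ is defined recursively by $X_1\equiv1$, $X_0\equiv0$, $X_t(w)=\mathbb P(X_{t^w}\mid\mathbf b(t^w))$ (for $w\models\neg\mathbf b(t)$, $t^w=t$ and $X_t(w)=\mathbb P(X_t\mid\mathbf b(t))$). $t\equiv s$ iff $X_t=X_s$ for every conditional probability on $A\times A'$; $\mathcal{T}(\mathbf A)$ is the Boolean algebra $\mathbb{T}(A)/\!\equiv$ with $[t]\wedge^*[s]=[t\wedge s]$, $[t]\vee^*[s]=[t\vee s]$, $\neg^*[t]=[\neg t]$, $0=[(\bot\mid\top)]$, $1=[(\top\mid\top)]$. *)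

theory Defs
  imports Complex_Main
begin

text \<open>The finite Boolean algebra \<open>A\<close> is a type of sort \<open>{finite, boolean_algebra}\<close>; \<open>A'\<close> is
  the set of its elements different from \<open>bot\<close>. Worlds are identified with atoms:
  the atom \<open>w\<close> stands for the homomorphism \<open>\<lambda>a. w \<le> a\<close>, so \<open>w \<Turnstile> a\<close> is written \<open>w \<le> a\<close>.
  The lemmas \<open>worlds_hom\<close> and \<open>hom_worlds\<close> below justify this.\<close>

definition worlds :: "'a::boolean_algebra set" where
  "worlds = {w. w \<noteq> bot \<and> (\<forall>a. a \<le> w \<longrightarrow> a = bot \<or> a = w)}"

definition bool_hom :: "('a::boolean_algebra \<Rightarrow> bool) \<Rightarrow> bool" where
  "bool_hom h \<longleftrightarrow> \<not> h bot \<and> h top \<and> (\<forall>a b. h (inf a b) = (h a \<and> h b)) \<and>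
     (\<forall>a b. h (sup a b) = (h a \<or> h b)) \<and> (\<forall>a. h (- a) = (\<not> h a))"

lemma world_le_or_disjoint: "w \<in> worlds \<Longrightarrow> w \<le> a \<or> inf w a = bot"
proof -
  assume "w \<in> worlds"
  moreover have "inf w a \<le> w" by (rule inf_le1)
  ultimately have "inf w a = bot \<or> inf w a = w" by (simp add: worlds_def)
  then show ?thesis by (auto simp: inf.absorb_iff1)
qed

lemma world_le_sup: "w \<in> worlds \<Longrightarrow> w \<le> sup a b \<longleftrightarrow> w \<le> a \<or> w \<le> b"
proof
  assume w: "w \<in> worlds" and le: "w \<le> sup a b"
  show "w \<le> a \<or> w \<le> b"
  proof (rule ccontr)
    assume "\<not> (w \<le> a \<or> w \<le> b)"
    then have "inf w a = bot" "inf w b = bot" using world_le_or_disjoint w by blast+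
    then have "inf w (sup a b) = bot" by (simp add: inf_sup_distrib1)
    then show False using le w by (simp add: inf.absorb1 worlds_def)
  qed
qed (auto intro: le_supI1 le_supI2)

lemma world_le_compl: "w \<in> worlds \<Longrightarrow> w \<le> - a \<longleftrightarrow> \<not> w \<le> a"
proof -
  assume w: "w \<in> worlds"
  have "w \<le> a \<or> w \<le> - a" using world_le_sup[OF w, of a "- a"] by simp
  moreover have "\<not> (w \<le> a \<and> w \<le> - a)"
  proof
    assume "w \<le> a \<and> w \<le> - a"
    then have "w \<le> inf a (- a)" by (simp only: le_inf_iff)
    then have "w \<le> bot" by (simp only: inf_compl_bot)
    then show False using w by (simp add: worlds_def bot_unique)
  qed
  ultimately show ?thesis by blast
qed

lemma worlds_hom: "w \<in> worlds \<Longrightarrow> bool_hom (\<lambda>a. w \<le> a)"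
  unfolding bool_hom_def
  by (simp add: world_le_sup world_le_compl bot_unique) (simp add: worlds_def)

lemma hom_worlds:
  fixes h :: "'a::{finite,boolean_algebra} \<Rightarrow> bool"
  assumes h: "bool_hom h"
  shows "\<exists>!w. w \<in> worlds \<and> h = (\<lambda>a. w \<le> a)"
proof -
  have h_inf: "h (inf a b) = (h a \<and> h b)" and h_compl: "h (- a) = (\<not> h a)" for a b
    using h by (auto simp: bool_hom_def)
  have fin: "finite {a. h a}" and ne: "{a. h a} \<noteq> {}"
    using h by (auto simp: bool_hom_def)
  define w where "w = Inf_fin {a. h a}"
  have "h (Inf_fin B)" if "finite B" "B \<noteq> {}" "B \<subseteq> {a. h a}" for B
    using that by (induction B rule: finite_ne_induct) (auto simp: h_inf)
  then have hw: "h w" using fin ne by (simp add: w_def)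
  have eq: "h a \<longleftrightarrow> w \<le> a" for a
  proof
    assume "h a" then show "w \<le> a" using fin by (simp add: w_def Inf_fin.coboundedI)
  next
    assume "w \<le> a" then have "inf w a = w" by (simp add: inf.absorb1)
    then show "h a" using hw h_inf[of w a] by simp
  qed
  have "w \<noteq> bot" using hw h by (auto simp: bool_hom_def)
  moreover have "a = bot \<or> a = w" if "a \<le> w" for a
  proof (cases "h a")
    case True then have "a = w" using eq that by (intro antisym) auto
    then show ?thesis by simp
  next
    case False
    then have "w \<le> - a" using h_compl eq by blast
    then have "a \<le> - a" using that by (rule order_trans[rotated])
    then have "inf a (- a) = a" by (rule inf.absorb1)
    then have "a = bot" by simp
    then show ?thesis by simp
  qed
  ultimately have ex: "w \<in> worlds" by (simp add: worlds_def)
  have uniq: "v = w" if "h = (\<lambda>a. v \<le> a)" for v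
  proof (rule antisym)
    have "v \<le> a \<longleftrightarrow> w \<le> a" for a using eq[of a] that by simp
    then show "v \<le> w" and "w \<le> v" by blast+
  qed
  have "h = (\<lambda>a. w \<le> a)" using eq by (intro ext) simp
  with ex show ?thesis by (intro ex1I[of _ w] conjI uniq) (erule conjunct2 | assumption)+
qed


datatype 'a cterm =
    Zero
  | One
  | Cond 'a 'a
  | Neg "'a cterm"
  | Conj "'a cterm" "'a cterm"
  | Disj "'a cterm" "'a cterm"

text \<open>\<open>Cond a b\<close> is the basic conditional \<open>(a | b)\<close>. The type also contains \<open>Cond a bot\<close>;
  the terms over \<open>A\<close> are those in which every antecedent is different from \<open>bot\<close>.\<close>

primrec wf_cterm :: "'a::boolean_algebra cterm \<Rightarrow> bool" where
  "wf_cterm Zero \<longleftrightarrow> True"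
| "wf_cterm One \<longleftrightarrow> True"
| "wf_cterm (Cond a b) \<longleftrightarrow> b \<noteq> bot"
| "wf_cterm (Neg t) \<longleftrightarrow> wf_cterm t"
| "wf_cterm (Conj t s) \<longleftrightarrow> wf_cterm t \<and> wf_cterm s"
| "wf_cterm (Disj t s) \<longleftrightarrow> wf_cterm t \<and> wf_cterm s"

definition cterms :: "'a::boolean_algebra cterm set" where
  "cterms = {t. wf_cterm t}"

primrec disj_antecedents :: "'a::boolean_algebra cterm \<Rightarrow> 'a" where
  "disj_antecedents Zero = bot"
| "disj_antecedents One = bot"
| "disj_antecedents (Cond a b) = b"
| "disj_antecedents (Neg t) = disj_antecedents t"
| "disj_antecedents (Conj t s) = sup (disj_antecedents t) (disj_antecedents s)"
| "disj_antecedents (Disj t s) = sup (disj_antecedents t) (disj_antecedents s)"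

definition bb :: "'a::boolean_algebra cterm \<Rightarrow> 'a" where
  "bb t = (if t = Zero \<or> t = One then top else disj_antecedents t)"


text \<open>The \<open>w\<close>-reduct: \<open>subst_world\<close> replaces the basic conditionals decided by \<open>w\<close>, and
  \<open>norm_cterm\<close> computes the normal form for the rewrite rules \<open>simp_step\<close>
  (lemma \<open>norm_cterm_iff\<close>).\<close>

primrec subst_world :: "'a::boolean_algebra \<Rightarrow> 'a cterm \<Rightarrow> 'a cterm" where
  "subst_world w Zero = Zero"
| "subst_world w One = One"
| "subst_world w (Cond a b) =
     (if w \<le> inf a b then One else if w \<le> inf (- a) b then Zero else Cond a b)"
| "subst_world w (Neg t) = Neg (subst_world w t)"
| "subst_world w (Conj t s) = Conj (subst_world w t) (subst_world w s)"
| "subst_world w (Disj t s) = Disj (subst_world w t) (subst_world w s)"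

inductive simp_step :: "'a cterm \<Rightarrow> 'a cterm \<Rightarrow> bool" where
  "simp_step (Neg One) Zero"
| "simp_step (Neg Zero) One"
| "simp_step (Conj r One) r"
| "simp_step (Conj One r) r"
| "simp_step (Conj r Zero) Zero"
| "simp_step (Conj Zero r) Zero"
| "simp_step (Disj r One) One"
| "simp_step (Disj One r) One"
| "simp_step (Disj r Zero) r"
| "simp_step (Disj Zero r) r"
| "simp_step t t' \<Longrightarrow> simp_step (Neg t) (Neg t')"
| "simp_step t t' \<Longrightarrow> simp_step (Conj t s) (Conj t' s)"
| "simp_step s s' \<Longrightarrow> simp_step (Conj t s) (Conj t s')"
| "simp_step t t' \<Longrightarrow> simp_step (Disj t s) (Disj t' s)"
| "simp_step s s' \<Longrightarrow> simp_step (Disj t s) (Disj t s')"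

definition mk_neg :: "'a cterm \<Rightarrow> 'a cterm" where
  "mk_neg t = (if t = One then Zero else if t = Zero then One else Neg t)"

definition mk_conj :: "'a cterm \<Rightarrow> 'a cterm \<Rightarrow> 'a cterm" where
  "mk_conj t s =
     (if s = One then t else if t = One then s
      else if t = Zero \<or> s = Zero then Zero else Conj t s)"

definition mk_disj :: "'a cterm \<Rightarrow> 'a cterm \<Rightarrow> 'a cterm" where
  "mk_disj t s =
     (if s = Zero then t else if t = Zero then s
      else if t = One \<or> s = One then One else Disj t s)"

lemmas mk_defs = mk_neg_def mk_conj_def mk_disj_def

primrec norm_cterm :: "'a cterm \<Rightarrow> 'a cterm" where
  "norm_cterm Zero = Zero"
| "norm_cterm One = One"
| "norm_cterm (Cond a b) = Cond a b"
| "norm_cterm (Neg t) = mk_neg (norm_cterm t)"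
| "norm_cterm (Conj t s) = mk_conj (norm_cterm t) (norm_cterm s)"
| "norm_cterm (Disj t s) = mk_disj (norm_cterm t) (norm_cterm s)"

lemma simp_step_norm: "simp_step t s \<Longrightarrow> norm_cterm t = norm_cterm s"
  by (induction rule: simp_step.induct) (auto simp: mk_defs)

lemma simp_steps_norm: "simp_step\<^sup>*\<^sup>* t s \<Longrightarrow> norm_cterm t = norm_cterm s"
  by (induction rule: rtranclp_induct) (auto dest: simp_step_norm)

lemma simp_steps_Neg: "simp_step\<^sup>*\<^sup>* t t' \<Longrightarrow> simp_step\<^sup>*\<^sup>* (Neg t) (Neg t')"
  by (induction rule: rtranclp_induct) (simp, erule rtranclp.rtrancl_into_rtrancl, erule simp_step.intros)

lemma simp_steps_Conj:
  assumes "simp_step\<^sup>*\<^sup>* t t'" "simp_step\<^sup>*\<^sup>* s s'"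
  shows "simp_step\<^sup>*\<^sup>* (Conj t s) (Conj t' s')"
proof -
  have "simp_step\<^sup>*\<^sup>* (Conj t s) (Conj t' s)" using assms(1)
    by (induction rule: rtranclp_induct) (simp, erule rtranclp.rtrancl_into_rtrancl, erule simp_step.intros)
  also have "simp_step\<^sup>*\<^sup>* (Conj t' s) (Conj t' s')" using assms(2)
    by (induction rule: rtranclp_induct) (simp, erule rtranclp.rtrancl_into_rtrancl, erule simp_step.intros)
  finally show ?thesis .
qed

lemma simp_steps_Disj:
  assumes "simp_step\<^sup>*\<^sup>* t t'" "simp_step\<^sup>*\<^sup>* s s'"
  shows "simp_step\<^sup>*\<^sup>* (Disj t s) (Disj t' s')"
proof -
  have "simp_step\<^sup>*\<^sup>* (Disj t s) (Disj t' s)" using assms(1)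
    by (induction rule: rtranclp_induct) (simp, erule rtranclp.rtrancl_into_rtrancl, erule simp_step.intros)
  also have "simp_step\<^sup>*\<^sup>* (Disj t' s) (Disj t' s')" using assms(2)
    by (induction rule: rtranclp_induct) (simp, erule rtranclp.rtrancl_into_rtrancl, erule simp_step.intros)
  finally show ?thesis .
qed

lemma mk_simp_steps:
  "simp_step\<^sup>*\<^sup>* (Neg t) (mk_neg t)"
  "simp_step\<^sup>*\<^sup>* (Conj t s) (mk_conj t s)"
  "simp_step\<^sup>*\<^sup>* (Disj t s) (mk_disj t s)"
  unfolding mk_defs by (auto intro!: r_into_rtranclp intro: simp_step.intros)

lemma simp_steps_to_norm: "simp_step\<^sup>*\<^sup>* t (norm_cterm t)"
proof (induction t)
  case (Neg t)
  show ?case using rtranclp_trans[OF simp_steps_Neg[OF Neg] mk_simp_steps(1)] by simp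
next
  case (Conj t s)
  show ?case using rtranclp_trans[OF simp_steps_Conj[OF Conj] mk_simp_steps(2)] by simp
next
  case (Disj t s)
  show ?case using rtranclp_trans[OF simp_steps_Disj[OF Disj] mk_simp_steps(3)] by simp
qed simp_all

inductive_cases simp_step_ZeroE: "simp_step Zero s"
inductive_cases simp_step_OneE: "simp_step One s"
inductive_cases simp_step_CondE: "simp_step (Cond a b) s"
inductive_cases simp_step_NegE: "simp_step (Neg t) s"
inductive_cases simp_step_ConjE: "simp_step (Conj t u) s"
inductive_cases simp_step_DisjE: "simp_step (Disj t u) s"

lemma norm_irreducible: "\<not> simp_step (norm_cterm t) s"
proof (induction t arbitrary: s)
  case (Neg t)
  then show ?case by (auto simp: mk_neg_def elim!: simp_step_ZeroE simp_step_OneE simp_step_NegE)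
next
  case (Conj t u)
  then show ?case by (auto simp: mk_conj_def elim!: simp_step_ZeroE simp_step_ConjE)
next
  case (Disj t u)
  then show ?case by (auto simp: mk_disj_def elim!: simp_step_OneE simp_step_DisjE)
qed (auto elim: simp_step_ZeroE simp_step_OneE simp_step_CondE)

lemma norm_cterm_iff: "norm_cterm t = s \<longleftrightarrow> simp_step\<^sup>*\<^sup>* t s \<and> (\<forall>u. \<not> simp_step s u)"
proof
  assume R: "simp_step\<^sup>*\<^sup>* t s \<and> (\<forall>u. \<not> simp_step s u)"
  then have "norm_cterm s = s"
    using simp_steps_to_norm[of s] by (auto elim: converse_rtranclpE)
  then show "norm_cterm t = s" using R simp_steps_norm by metis
qed (use simp_steps_to_norm norm_irreducible in blast)

definition reduct :: "'a::boolean_algebra \<Rightarrow> 'a cterm \<Rightarrow> 'a cterm" where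
  "reduct w t = norm_cterm (subst_world w t)"


text \<open>\<open>P a b\<close> stands for \<open>P(a | b)\<close>; the values \<open>P a bot\<close> lie outside the domain and are
  left unconstrained. The product rule is required whenever both of its conditions are
  different from \<open>bot\<close>.\<close>

definition cond_prob :: "('a::boolean_algebra \<Rightarrow> 'a \<Rightarrow> real) \<Rightarrow> bool" where
  "cond_prob P \<longleftrightarrow>
     (\<forall>a b. b \<noteq> bot \<longrightarrow> 0 \<le> P a b \<and> P a b \<le> 1) \<and>
     (\<forall>b. b \<noteq> bot \<longrightarrow> P top b = 1) \<and>
     (\<forall>a c b. b \<noteq> bot \<longrightarrow> inf a c = bot \<longrightarrow> P (sup a c) b = P a b + P c b) \<and>
     (\<forall>b. b \<noteq> bot \<longrightarrow> P b b = 1) \<and>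
     (\<forall>a b c. inf b c \<noteq> bot \<longrightarrow> P (inf a b) c = P a (inf b c) * P b c)"

definition cond_expect :: "('a::boolean_algebra \<Rightarrow> 'a \<Rightarrow> real) \<Rightarrow> ('a \<Rightarrow> real) \<Rightarrow> 'a \<Rightarrow> real" where
  "cond_expect P X b = (\<Sum>w\<in>worlds. X w * P w b)"

lemma cond_expect_cong [fundef_cong]:
  "P = P' \<Longrightarrow> b = b' \<Longrightarrow> (\<And>w. w \<in> worlds \<Longrightarrow> X w = Y w) \<Longrightarrow>
    cond_expect P X b = cond_expect P' Y b'"
  by (simp add: cond_expect_def)


text \<open>In \<open>X\<^sub>t(w) = \<P>(X\<^bsub>t\<^sup>w\<^esub> | b(t\<^sup>w))\<close> the worlds outside \<open>b(t\<^sup>w)\<close> have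
  probability \<open>0\<close>. They are cut off in the definition of \<open>rv\<close> so that the recursion is
  well-founded also when \<open>t\<^sup>w = t\<close>; lemma \<open>rv_eq\<close> gives the equation without the cut-off.\<close>

primrec weight :: "'a cterm \<Rightarrow> nat" where
  "weight Zero = 1"
| "weight One = 1"
| "weight (Cond a b) = 2"
| "weight (Neg t) = 1 + weight t"
| "weight (Conj t s) = 1 + weight t + weight s"
| "weight (Disj t s) = 1 + weight t + weight s"

lemma weight_norm: "norm_cterm t = t \<or> weight (norm_cterm t) < weight t"
  by (induction t) (auto simp: mk_defs)

lemma weight_subst_world: "subst_world w t = t \<or> weight (subst_world w t) < weight t"
  by (induction t) auto

lemma weight_reduct: "reduct w t = t \<or> weight (reduct w t) < weight t"
  unfolding reduct_def using weight_norm[of "subst_world w t"] weight_subst_world[of w t]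
  by (metis less_trans)

lemma reduct_eq_imp_subst_world_eq: "reduct w t = t \<Longrightarrow> subst_world w t = t"
  unfolding reduct_def using weight_norm[of "subst_world w t"] weight_subst_world[of w t]
  by (metis less_asym)

lemma subst_world_neq:
  "v \<in> worlds \<Longrightarrow> v \<le> disj_antecedents t \<Longrightarrow> subst_world v t \<noteq> t"
proof (induction t)
  case (Cond a b)
  then show ?case using world_le_compl[of v a] by auto
qed (auto simp: world_le_sup bot_unique worlds_def)

lemma reduct_neq:
  "v \<in> worlds \<Longrightarrow> t \<noteq> Zero \<Longrightarrow> t \<noteq> One \<Longrightarrow> v \<le> bb t \<Longrightarrow> reduct v t \<noteq> t"
  using subst_world_neq reduct_eq_imp_subst_world_eq by (metis bb_def)

function rv :: "('a::{finite,boolean_algebra} \<Rightarrow> 'a \<Rightarrow> real) \<Rightarrow> 'a cterm \<Rightarrow> 'a \<Rightarrow> real" where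
  "rv P t w =
     (if t = One then 1 else if t = Zero then 0
      else cond_expect P (\<lambda>v. if v \<le> bb (reduct w t) then rv P (reduct w t) v else 0)
             (bb (reduct w t)))"
  by pat_completeness auto
termination
proof (relation "measures [\<lambda>(P, t, w). weight t, \<lambda>(P, t, w). if reduct w t = t then 1 else 0]")
  fix P :: "'a \<Rightarrow> 'a \<Rightarrow> real" and t :: "'a cterm" and w v :: 'a
  assume "t \<noteq> One" "t \<noteq> Zero" "v \<in> worlds" "v \<le> bb (reduct w t)"
  then show "((P, reduct w t, v), P, t, w) \<in>
      measures [\<lambda>(P, t, w). weight t, \<lambda>(P, t, w). if reduct w t = t then 1 else 0]"
    using weight_reduct[of w t] reduct_neq[of v t] by (cases "reduct w t = t") auto
qed simp

declare rv.simps [simp del]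

lemma disj_antecedents_norm_neq_bot:
  "wf_cterm t \<Longrightarrow> norm_cterm t \<noteq> Zero \<Longrightarrow> norm_cterm t \<noteq> One \<Longrightarrow>
    disj_antecedents (norm_cterm t) \<noteq> bot"
  by (induction t) (auto simp: mk_defs sup_eq_bot_iff split: if_splits)

lemma wf_subst_world: "wf_cterm t \<Longrightarrow> wf_cterm (subst_world w t)"
  by (induction t) auto

lemma cond_prob_disjoint:
  assumes "cond_prob P" "b \<noteq> bot" "inf a b = bot"
  shows "P a b = 0"
proof -
  have bounds: "0 \<le> P x b" "P x b \<le> 1" for x
    using assms(1,2) unfolding cond_prob_def by blast+
  have "P (sup a b) b = P a b + P b b" "P b b = 1"
    using assms unfolding cond_prob_def by blast+
  then show ?thesis using bounds(1)[of a] bounds(2)[of "sup a b"] by linarith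
qed

lemma rv_eq:
  fixes P :: "'a::{finite,boolean_algebra} \<Rightarrow> 'a \<Rightarrow> real"
  assumes "cond_prob P" "t \<in> cterms" "t \<noteq> Zero" "t \<noteq> One" "(bot :: 'a) \<noteq> top"
  shows "rv P t w = cond_expect P (rv P (reduct w t)) (bb (reduct w t))"
proof -
  let ?b = "bb (reduct w t)"
  have "?b \<noteq> bot"
    using assms disj_antecedents_norm_neq_bot[OF wf_subst_world, of t w]
    by (auto simp: bb_def reduct_def cterms_def)
  then have "P v ?b = 0" if "v \<in> worlds" "\<not> v \<le> ?b" for v
    using that world_le_or_disjoint[of v ?b] cond_prob_disjoint assms(1) by blast
  then have "(if v \<le> ?b then rv P (reduct w t) v else 0) * P v ?b = rv P (reduct w t) v * P v ?b"
    if "v \<in> worlds" for v using that by auto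
  then have "cond_expect P (\<lambda>v. if v \<le> ?b then rv P (reduct w t) v else 0) ?b =
      cond_expect P (rv P (reduct w t)) ?b"
    unfolding cond_expect_def by (rule sum.cong[OF refl])
  then show ?thesis using assms(3,4) by (subst rv.simps) simp
qed


definition cond_equiv :: "('a::{finite,boolean_algebra} cterm \<times> 'a cterm) set" where
  "cond_equiv = {(t, s). t \<in> cterms \<and> s \<in> cterms \<and>
     (\<forall>P. cond_prob P \<longrightarrow> (\<forall>w\<in>worlds. rv P t w = rv P s w))}"

definition cond_class :: "'a::{finite,boolean_algebra} cterm \<Rightarrow> 'a cterm set" where
  "cond_class t = cond_equiv `` {t}"

lemma equiv_cond_equiv: "equiv cterms cond_equiv"
  by (auto simp: equiv_def cond_equiv_def refl_on_def sym_def trans_def)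

record 'b bool_alg =
  ba_carrier :: "'b set"
  ba_meet :: "'b \<Rightarrow> 'b \<Rightarrow> 'b"
  ba_join :: "'b \<Rightarrow> 'b \<Rightarrow> 'b"
  ba_compl :: "'b \<Rightarrow> 'b"
  ba_zero :: 'b
  ba_one :: 'b

definition ba_le :: "'b bool_alg \<Rightarrow> 'b \<Rightarrow> 'b \<Rightarrow> bool" where
  "ba_le B x y \<longleftrightarrow> ba_meet B x y = x"

definition ba_atoms :: "'b bool_alg \<Rightarrow> 'b set" where
  "ba_atoms B = {x \<in> ba_carrier B. x \<noteq> ba_zero B \<and>
     (\<forall>y\<in>ba_carrier B. ba_le B y x \<longrightarrow> y = ba_zero B \<or> y = x)}"

text \<open>The operations on classes are the unions of the classes obtained from representatives.\<close>

definition cond_algebra :: "'a::{finite,boolean_algebra} cterm set bool_alg" where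
  "cond_algebra = \<lparr>
     ba_carrier = cterms // cond_equiv,
     ba_meet = (\<lambda>C D. \<Union>t\<in>C. \<Union>s\<in>D. cond_class (Conj t s)),
     ba_join = (\<lambda>C D. \<Union>t\<in>C. \<Union>s\<in>D. cond_class (Disj t s)),
     ba_compl = (\<lambda>C. \<Union>t\<in>C. cond_class (Neg t)),
     ba_zero = cond_class (Cond bot top),
     ba_one = cond_class (Cond top top)\<rparr>"


text \<open>The empty conjunction (needed for \<open>n = 1\<close>) is the constant \<open>1\<close>.\<close>

fun conj_list :: "'a cterm list \<Rightarrow> 'a cterm" where
  "conj_list [] = One"
| "conj_list [t] = t"
| "conj_list (t # ts) = Conj t (conj_list ts)"

definition inf_compls :: "'a::boolean_algebra list \<Rightarrow> 'a" where
  "inf_compls bs = foldr (\<lambda>b c. inf (- b) c) bs top"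

definition omega :: "'a::boolean_algebra list \<Rightarrow> 'a cterm" where
  "omega bs = conj_list (map (\<lambda>i. Cond (bs ! i) (inf_compls (take i bs))) [0..<length bs])"

end

theory Submission
  imports Defs "HOL-Combinatorics.Multiset_Permutations" "HOL-Library.Sublist"
begin

text \<open>An ordering of the worlds decides the basic conditional \<open>(a | b)\<close> by its first world
  below \<open>b\<close>, and hence decides every term. A conditional probability \<open>P\<close> induces a random
  ordering: draw worlds one after the other without replacement, each according to \<open>P\<close>
  conditioned on the worlds not drawn yet. By the product rule, the induced ordering of the
  worlds below \<open>b\<close> is distributed as if one had started drawing from \<open>b\<close>, and therefore
  \<open>X\<^sub>t(w)\<close> is the probability that \<open>t\<close> is true given that the ordering starts with \<open>w\<close>.
  Conversely, every ordering arises with probability one from the \<open>{0,1}\<close>-valued conditional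
  probability that it induces. Hence two terms are equivalent iff they are true at the same
  orderings, and \<open>\<omega>\<^bsub>\<langle>\<beta>\<rangle>\<^esub>\<close> is true at exactly one ordering, the one that extends \<open>\<beta>\<close>.\<close>

section \<open>Worlds below an element\<close>

definition below :: "'a::boolean_algebra \<Rightarrow> 'a set" where
  "below b = {w \<in> worlds. w \<le> b}"

lemma mem_below_iff [simp]: "w \<in> below b \<longleftrightarrow> w \<in> worlds \<and> w \<le> b"
  by (simp add: below_def)

lemma not_world_le_bot: "w \<in> worlds \<Longrightarrow> \<not> w \<le> bot"
  by (simp add: worlds_def bot_unique)

lemma world_le_world: "v \<in> worlds \<Longrightarrow> w \<in> worlds \<Longrightarrow> v \<le> w \<longleftrightarrow> v = w"
  by (auto simp: worlds_def)

lemma world_le_diff: "v \<in> worlds \<Longrightarrow> w \<in> worlds \<Longrightarrow> w \<le> b - v \<longleftrightarrow> w \<le> b \<and> w \<noteq> v"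
  by (auto simp: diff_eq world_le_compl world_le_world)

lemma le_diff_world:
  assumes "v \<in> worlds"
  shows "b \<le> c - v \<longleftrightarrow> b \<le> c \<and> \<not> v \<le> b"
proof -
  have "b \<le> - v \<longleftrightarrow> v \<le> - b" by (blast intro: compl_le_swap1)
  then show ?thesis using assms by (simp add: diff_eq world_le_compl)
qed

lemma below_bot [simp]: "below bot = {}"
  by (auto simp: not_world_le_bot)

lemma below_top [simp]: "below top = worlds"
  by auto

lemma below_mono: "b \<le> c \<Longrightarrow> below b \<subseteq> below c"
  by auto

lemma below_diff: "v \<in> worlds \<Longrightarrow> below (b - v) = below b - {v}"
  by (auto simp: world_le_diff)

lemma below_nonempty:
  fixes b :: "'a::{finite,boolean_algebra}"
  assumes "b \<noteq> bot"
  shows "below b \<noteq> {}"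
proof -
  obtain m where minimal_in: "m \<noteq> bot" "m \<le> b"
    and minimal: "\<And>x. x \<noteq> bot \<Longrightarrow> x \<le> b \<Longrightarrow> x \<le> m \<Longrightarrow> m = x"
    using finite_has_minimal2[of "{x. x \<noteq> bot \<and> x \<le> b}" b] assms by auto
  then have "m \<in> worlds"
    unfolding worlds_def by (auto dest: order_trans)
  with minimal_in show ?thesis by auto
qed

lemma remove_world_induct [case_names bot remove]:
  fixes b :: "'a::{finite,boolean_algebra}"
  assumes bot: "Q bot"
    and remove: "\<And>b. b \<noteq> bot \<Longrightarrow> (\<And>v. v \<in> below b \<Longrightarrow> Q (b - v)) \<Longrightarrow> Q b"
  shows "Q b"
proof (induction "card (below b)" arbitrary: b rule: less_induct)
  case less
  show ?case
  proof (cases "b = bot")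
    case False
    have "Q (b - v)" if below: "v \<in> below b" for v
    proof (rule less)
      show "card (below (b - v)) < card (below b)"
        using below card_Diff1_less[OF _ below] by (simp add: below_diff del: card_Diff_insert)
    qed
    with False show ?thesis by (rule remove)
  qed (simp add: bot)
qed

lemma Cons_permutations_below_iff:
  "v # l \<in> permutations_of_set (below b) \<longleftrightarrow>
    v \<in> below b \<and> l \<in> permutations_of_set (below (b - v))"
proof (cases "v \<in> below b")
  case True
  then have "below (b - v) = below b - {v}" by (simp add: below_diff)
  with True have "insert v (set l) = below b \<and> v \<notin> set l \<longleftrightarrow> set l = below (b - v)"
    by blast
  with True show ?thesis by (auto simp: permutations_of_set_def simp del: mem_below_iff)
qed (auto simp: permutations_of_set_def)

lemma filter_le_diff_world:
  assumes "v \<in> worlds" "l \<in> permutations_of_set (below (c - v))"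
  shows "filter (\<lambda>w. w \<le> b - v) l = filter (\<lambda>w. w \<le> b) l"
  using assms permutations_of_setD(1)[OF assms(2)]
  by (intro filter_cong) (auto simp: world_le_diff)

section \<open>Reducts\<close>

lemma wf_norm_cterm: "wf_cterm t \<Longrightarrow> wf_cterm (norm_cterm t)"
  by (induction t) (auto simp: mk_defs)

lemma wf_reduct: "wf_cterm t \<Longrightarrow> wf_cterm (reduct w t)"
  by (simp add: reduct_def wf_norm_cterm wf_subst_world)

lemma disj_antecedents_norm_le: "disj_antecedents (norm_cterm t) \<le> disj_antecedents t"
  by (induction t) (auto simp: mk_defs intro: le_supI1 le_supI2)

lemma disj_antecedents_subst_world_le:
  assumes "w \<in> worlds"
  shows "disj_antecedents (subst_world w t) \<le> disj_antecedents t - w"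
proof (induction t)
  case (Cond a b)
  show ?case using assms by (auto simp: world_le_compl le_diff_world not_world_le_bot)
qed (auto simp: diff_eq inf_sup_distrib2 intro: le_supI1 le_supI2)

lemma disj_antecedents_reduct_le:
  "w \<in> worlds \<Longrightarrow> disj_antecedents (reduct w t) \<le> disj_antecedents t - w"
  unfolding reduct_def
  using disj_antecedents_norm_le disj_antecedents_subst_world_le by (rule order_trans)

lemma disj_antecedents_le_bb: "disj_antecedents t \<le> bb t"
  by (simp add: bb_def)

lemma bb_reduct_neq_bot:
  assumes "(bot :: 'a::boolean_algebra) \<noteq> top" "wf_cterm (t :: 'a cterm)"
  shows "bb (reduct w t) \<noteq> bot"
  using assms disj_antecedents_norm_neq_bot[OF wf_subst_world, of t w]
  by (auto simp: bb_def reduct_def)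

section \<open>Truth of a term at an ordering\<close>

primrec holds :: "'a::boolean_algebra list \<Rightarrow> 'a cterm \<Rightarrow> bool" where
  "holds l Zero \<longleftrightarrow> False"
| "holds l One \<longleftrightarrow> True"
| "holds l (Cond a b) \<longleftrightarrow> (\<exists>v. find (\<lambda>w. w \<le> b) l = Some v \<and> v \<le> a)"
| "holds l (Neg t) \<longleftrightarrow> \<not> holds l t"
| "holds l (Conj t s) \<longleftrightarrow> holds l t \<and> holds l s"
| "holds l (Disj t s) \<longleftrightarrow> holds l t \<or> holds l s"

lemma holds_norm_cterm: "holds l (norm_cterm t) \<longleftrightarrow> holds l t"
proof -
  have "holds l (mk_neg t) \<longleftrightarrow> holds l (Neg t)"
    "holds l (mk_conj t s) \<longleftrightarrow> holds l (Conj t s)"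
    "holds l (mk_disj t s) \<longleftrightarrow> holds l (Disj t s)" for t s
    by (auto simp: mk_defs)
  then show ?thesis by (induction t) simp_all
qed

lemma holds_subst_world:
  "w \<in> worlds \<Longrightarrow> holds l (subst_world w t) \<longleftrightarrow> holds (w # l) t"
  by (induction t) (auto simp: world_le_compl)

lemma holds_reduct: "w \<in> worlds \<Longrightarrow> holds l (reduct w t) \<longleftrightarrow> holds (w # l) t"
  by (simp add: reduct_def holds_norm_cterm holds_subst_world)

lemma find_SomeD:
  assumes "find p l = Some v"
  shows "v \<in> set l" "p v"
  using assms by (auto simp: find_Some_iff)

lemma find_filter_implied:
  assumes "\<And>x. p x \<Longrightarrow> q x"
  shows "find p (filter q l) = find p l"
  using assms by (induction l) auto

lemma holds_filter:
  "disj_antecedents t \<le> b \<Longrightarrow> holds (filter (\<lambda>w. w \<le> b) l) t \<longleftrightarrow> holds l t"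
  by (induction t) (auto simp: find_filter_implied)

definition models :: "'a::boolean_algebra cterm \<Rightarrow> 'a list set" where
  "models t = {l \<in> permutations_of_set worlds. holds l t}"

lemma models_Conj [simp]: "models (Conj t s) = models t \<inter> models s"
  by (auto simp: models_def)

lemma models_Cond_bot [simp]: "models (Cond bot b) = {}"
  by (auto simp: models_def permutations_of_set_def not_world_le_bot dest: find_SomeD)

section \<open>Drawing worlds without replacement\<close>

primrec draw_prob :: "('a::boolean_algebra \<Rightarrow> 'a \<Rightarrow> real) \<Rightarrow> 'a list \<Rightarrow> 'a \<Rightarrow> real" where
  "draw_prob P [] b = 1"
| "draw_prob P (v # l) b = P v b * draw_prob P l (b - v)"

definition draw_expect ::
  "('a::boolean_algebra \<Rightarrow> 'a \<Rightarrow> real) \<Rightarrow> 'a \<Rightarrow> ('a list \<Rightarrow> real) \<Rightarrow> real" where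
  "draw_expect P b F = (\<Sum>l\<in>permutations_of_set (below b). draw_prob P l b * F l)"

lemma draw_expect_bot [simp]: "draw_expect P bot F = F []"
  by (simp add: draw_expect_def)

lemma draw_expect_cong:
  assumes "\<And>l. l \<in> permutations_of_set (below b) \<Longrightarrow> F l = G l"
  shows "draw_expect P b F = draw_expect P b G"
  using assms by (simp add: draw_expect_def)

lemma draw_expect_step:
  fixes b :: "'a::{finite,boolean_algebra}"
  assumes "b \<noteq> bot"
  shows "draw_expect P b F =
    (\<Sum>v\<in>below b. P v b * draw_expect P (b - v) (\<lambda>l. F (v # l)))"
proof -
  let ?\<Pi> = "\<lambda>v. permutations_of_set (below b - {v})"
  have "draw_expect P b F =
      (\<Sum>l\<in>(\<Union>v\<in>below b. (#) v ` ?\<Pi> v). draw_prob P l b * F l)"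
    using below_nonempty[OF assms] by (simp add: draw_expect_def permutations_of_set_nonempty)
  also have "\<dots> = (\<Sum>v\<in>below b. \<Sum>l\<in>(#) v ` ?\<Pi> v. draw_prob P l b * F l)"
    by (intro sum.UNION_disjoint) auto
  also have "\<dots> = (\<Sum>v\<in>below b. \<Sum>l\<in>?\<Pi> v. P v b * (draw_prob P l (b - v) * F (v # l)))"
    by (simp add: sum.reindex mult.assoc)
  also have "\<dots> = (\<Sum>v\<in>below b. P v b * draw_expect P (b - v) (\<lambda>l. F (v # l)))"
    by (intro sum.cong) (simp_all add: draw_expect_def sum_distrib_left below_diff)
  finally show ?thesis .
qed

abbreviation truth_prob :: "('a::boolean_algebra \<Rightarrow> 'a \<Rightarrow> real) \<Rightarrow> 'a \<Rightarrow> 'a cterm \<Rightarrow> real" where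
  "truth_prob P b t \<equiv> draw_expect P b (\<lambda>l. of_bool (holds l t))"

context
  fixes P :: "'a::{finite,boolean_algebra} \<Rightarrow> 'a \<Rightarrow> real"
  assumes prob: "cond_prob P"
begin

lemma cond_prob_eq_sum_below:
  assumes "c \<noteq> bot"
  shows "P a c = (\<Sum>v\<in>below a. P v c)"
proof (induction a rule: remove_world_induct)
  case bot
  show ?case using cond_prob_disjoint[OF prob assms, of bot] by simp
next
  case (remove a)
  then obtain v where below: "v \<in> below a" using below_nonempty by blast
  have "sup (a - v) v = a"
    using below by (simp add: diff_eq sup_inf_distrib2 sup.absorb1)
  moreover have "P (sup (a - v) v) c = P (a - v) c + P v c"
    using prob assms unfolding cond_prob_def by (simp add: diff_eq inf_assoc)
  ultimately have "P a c = P (a - v) c + P v c" by simp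
  also have "\<dots> = (\<Sum>v\<in>below a. P v c)"
    using below remove by (simp add: below_diff sum.remove[of _ v])
  finally show ?case .
qed

lemma cond_prob_sum_below:
  "c \<noteq> bot \<Longrightarrow> (\<Sum>v\<in>below c. P v c) = 1"
  using cond_prob_eq_sum_below[of c c] prob by (simp add: cond_prob_def)

lemma cond_prob_chain:
  assumes "b \<noteq> bot" "v \<le> b" "b \<le> c"
  shows "P v c = P v b * P b c"
  using prob assms unfolding cond_prob_def by (metis inf.absorb1)

lemma cond_expect_eq_sum_below:
  assumes "b \<noteq> bot"
  shows "cond_expect P X b = (\<Sum>v\<in>below b. P v b * X v)"
proof -
  have "P v b = 0" if "v \<in> worlds - below b" for v
    using that world_le_or_disjoint[of v b] cond_prob_disjoint[OF prob assms]
    by auto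
  then have "(\<Sum>v\<in>below b. P v b * X v) = (\<Sum>v\<in>worlds. P v b * X v)"
    by (intro sum.mono_neutral_left) auto
  then show ?thesis by (simp add: cond_expect_def mult.commute)
qed

lemma draw_expect_chain:
  assumes "b \<le> c" "c \<noteq> bot"
  shows "(\<Sum>v\<in>below b. P v c * draw_expect P (b - v) (\<lambda>l. F (v # l))) =
    P b c * draw_expect P b F"
proof (cases "b = bot")
  case True
  then show ?thesis using cond_prob_disjoint[OF prob assms(2), of bot] by simp
next
  case False
  have "P v c = P b c * P v b" if "v \<in> below b" for v
    using cond_prob_chain[OF False _ assms(1), of v] that by simp
  then show ?thesis
    using False by (simp add: draw_expect_step sum_distrib_left mult.assoc)
qed

lemma draw_expect_filter:
  assumes "b \<le> c"
  shows "draw_expect P c (\<lambda>l. F (filter (\<lambda>w. w \<le> b) l)) = draw_expect P b F"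
  using assms
proof (induction c arbitrary: b F rule: remove_world_induct)
  case bot
  then show ?case by (simp add: bot_unique)
next
  case (remove c)
  let ?G = "\<lambda>l. F (filter (\<lambda>w. w \<le> b) l)"
  have inside: "draw_expect P (c - v) (\<lambda>l. ?G (v # l)) = draw_expect P (b - v) (\<lambda>l. F (v # l))"
    if "v \<in> below b" for v
  proof -
    have "draw_expect P (c - v) (\<lambda>l. ?G (v # l)) =
        draw_expect P (c - v) (\<lambda>l. F (v # filter (\<lambda>w. w \<le> b - v) l))"
      using that by (intro draw_expect_cong) (simp add: filter_le_diff_world)
    also have "\<dots> = draw_expect P (b - v) (\<lambda>l. F (v # l))"
      using that below_mono[OF remove.prems] remove.prems
      by (intro remove.IH) (auto simp: diff_eq intro: le_infI1)
    finally show ?thesis .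
  qed
  have outside: "draw_expect P (c - v) (\<lambda>l. ?G (v # l)) = draw_expect P b F"
    if "v \<in> below c - below b" for v
    using that remove.prems remove.IH by (simp add: le_diff_world)
  have split: "(\<Sum>v\<in>below c. g v) = (\<Sum>v\<in>below c - below b. g v) + (\<Sum>v\<in>below b. g v)"
    for g :: "'a \<Rightarrow> real"
    using below_mono[OF remove.prems] by (intro sum.subset_diff) simp_all
  have "draw_expect P c ?G = (\<Sum>v\<in>below c - below b. P v c * draw_expect P b F)
      + (\<Sum>v\<in>below b. P v c * draw_expect P (b - v) (\<lambda>l. F (v # l)))"
    using remove.hyps by (simp add: draw_expect_step split inside outside del: filter.simps)
  also have "\<dots> = (\<Sum>v\<in>below c. P v c) * draw_expect P b F"
    unfolding draw_expect_chain[OF remove.prems remove.hyps] split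
    by (simp add: cond_prob_eq_sum_below[OF remove.hyps, of b] sum_distrib_right distrib_right)
  finally show ?case by (simp add: cond_prob_sum_below[OF remove.hyps])
qed

lemma draw_expect_const: "draw_expect P b (\<lambda>l. k) = k"
  using draw_expect_filter[of bot b "\<lambda>l. k"] by simp

lemma truth_prob_eqI:
  assumes "disj_antecedents t \<le> b" "disj_antecedents t \<le> c"
  shows "truth_prob P b t = truth_prob P c t"
proof -
  have "truth_prob P d t = truth_prob P (disj_antecedents t) t" if "disj_antecedents t \<le> d" for d
    using draw_expect_filter[OF that, of "\<lambda>l. of_bool (holds l t)"] by (simp add: holds_filter)
  from this[OF assms(1)] this[OF assms(2)] show ?thesis by simp
qed

lemma cond_expect_truth_prob:
  assumes "disj_antecedents t \<le> b" "b \<noteq> bot"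
  shows "cond_expect P (\<lambda>v. draw_expect P (- v) (\<lambda>l. of_bool (holds (v # l) t))) b =
    truth_prob P b t"
proof -
  have "truth_prob P (- v) (reduct v t) = truth_prob P (b - v) (reduct v t)" if "v \<in> below b" for v
  proof -
    have "disj_antecedents (reduct v t) \<le> disj_antecedents t - v"
      using that disj_antecedents_reduct_le[of v t] by simp
    then show ?thesis
      using assms(1) by (intro truth_prob_eqI) (auto simp: diff_eq)
  qed
  then show ?thesis
    using assms(2)
    by (simp add: cond_expect_eq_sum_below draw_expect_step holds_reduct)
qed

end

lemma rv_eq_draw_expect:
  fixes P :: "'a::{finite,boolean_algebra} \<Rightarrow> 'a \<Rightarrow> real"
  assumes nontriv: "(bot :: 'a) \<noteq> top"
    and "cond_prob P" "wf_cterm t" "w \<in> worlds"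
  shows "rv P t w = draw_expect P (- w) (\<lambda>l. of_bool (holds (w # l) t))"
  using assms(2-)
proof (induction P t w rule: rv.induct)
  case (1 P t w)
  note prob = \<open>cond_prob P\<close> and world = \<open>w \<in> worlds\<close>
  show ?case
  proof (cases "t = One \<or> t = Zero")
    case True
    then show ?thesis by (auto simp: rv.simps draw_expect_const[OF prob])
  next
    case False
    define r where "r = reduct w t"
    have r_props: "wf_cterm r" "bb r \<noteq> bot" "disj_antecedents r \<le> - w"
      using "1.prems" nontriv disj_antecedents_reduct_le[OF world, of t]
      by (simp_all add: r_def wf_reduct bb_reduct_neq_bot diff_eq)
    have "rv P r v = draw_expect P (- v) (\<lambda>l. of_bool (holds (v # l) r))"
      if "v \<in> below (bb r)" for v
      using False that prob r_props(1) unfolding r_def by (intro "1.IH") auto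
    then have "rv P t w =
        cond_expect P (\<lambda>v. draw_expect P (- v) (\<lambda>l. of_bool (holds (v # l) r))) (bb r)"
      using False rv_eq[OF prob _ _ _ nontriv, of t w] "1.prems" r_props(2)
      by (simp add: cterms_def cond_expect_eq_sum_below[OF prob] flip: r_def)
    also have "\<dots> = truth_prob P (bb r) r"
      using r_props(2) by (intro cond_expect_truth_prob[OF prob] disj_antecedents_le_bb)
    also have "\<dots> = truth_prob P (- w) r"
      using r_props(3) by (intro truth_prob_eqI[OF prob] disj_antecedents_le_bb)
    finally show ?thesis using world by (simp add: r_def holds_reduct)
  qed
qed

section \<open>The conditional probability concentrated at an ordering\<close>

definition dirac_cond_prob :: "'a::boolean_algebra list \<Rightarrow> 'a \<Rightarrow> 'a \<Rightarrow> real" where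
  "dirac_cond_prob l a b = of_bool (holds l (Cond a b))"

lemma find_world_below:
  fixes b :: "'a::{finite,boolean_algebra}"
  assumes "set l = worlds" "b \<noteq> bot"
  obtains v where "find (\<lambda>w. w \<le> b) l = Some v" "v \<in> below b"
proof (cases "find (\<lambda>w. w \<le> b) l")
  case None
  then show ?thesis using below_nonempty[OF assms(2)] assms(1) by (auto simp: find_None_iff)
next
  case (Some v)
  then have "v \<in> below b" using find_SomeD[OF Some] assms(1) by simp
  with Some show ?thesis by (rule that)
qed

lemma find_conj_eq_Some:
  "find p l = Some v \<Longrightarrow> q v \<Longrightarrow> find (\<lambda>x. q x \<and> p x) l = Some v"
  by (induction l) (auto split: if_splits)

lemma cond_prob_dirac:
  fixes l :: "'a::{finite,boolean_algebra} list"
  assumes set: "set l = worlds"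
  shows "cond_prob (dirac_cond_prob l)"
  unfolding cond_prob_def
proof (intro conjI allI impI)
  fix a b c :: 'a
  show "dirac_cond_prob l top b = 1" "dirac_cond_prob l b b = 1" if "b \<noteq> bot"
    using find_world_below[OF set that] by (auto simp: dirac_cond_prob_def)
  show "dirac_cond_prob l (sup a c) b = dirac_cond_prob l a b + dirac_cond_prob l c b"
    if nonbot: "b \<noteq> bot" and disjoint: "inf a c = bot"
  proof -
    obtain v where first: "find (\<lambda>w. w \<le> b) l = Some v" "v \<in> worlds"
      using find_world_below[OF set nonbot] by auto
    have "\<not> (v \<le> a \<and> v \<le> c)"
      using not_world_le_bot[OF first(2)] by (simp flip: disjoint)
    then show ?thesis using first by (auto simp: dirac_cond_prob_def world_le_sup)
  qed
  show "dirac_cond_prob l (inf a b) c = dirac_cond_prob l a (inf b c) * dirac_cond_prob l b c"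
    if "inf b c \<noteq> bot"
  proof -
    have "c \<noteq> bot" using that by auto
    then obtain v where first: "find (\<lambda>w. w \<le> c) l = Some v"
      using find_world_below[OF set] by blast
    show ?thesis
      using first find_conj_eq_Some[OF first, of "\<lambda>w. w \<le> b"] by (auto simp: dirac_cond_prob_def)
  qed
qed (auto simp: dirac_cond_prob_def)

lemma filter_eq_Cons_iff_find:
  assumes "distinct l"
  shows "filter p l = v # k \<longleftrightarrow> find p l = Some v \<and> filter (\<lambda>x. p x \<and> x \<noteq> v) l = k"
  using assms
proof (induction l)
  case (Cons x l)
  have "filter (\<lambda>y. p y \<and> y \<noteq> x) l = filter p l"
    using Cons.prems by (intro filter_cong) auto
  then show ?case using Cons by auto
qed simp

lemma draw_prob_dirac:
  fixes b :: "'a::{finite,boolean_algebra}"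
  assumes ordering: "l \<in> permutations_of_set worlds"
    and "k \<in> permutations_of_set (below b)"
  shows "draw_prob (dirac_cond_prob l) k b = of_bool (filter (\<lambda>w. w \<le> b) l = k)"
  using assms(2)
proof (induction k arbitrary: b)
  case Nil
  then show ?case
    using permutations_of_setD(1)[OF ordering]
    by (auto simp: permutations_of_set_def filter_empty_conv)
next
  case (Cons v k)
  then have world: "v \<in> worlds" "v \<le> b" and rest: "k \<in> permutations_of_set (below (b - v))"
    by (simp_all add: Cons_permutations_below_iff)
  have "u = v" if "find (\<lambda>w. w \<le> b) l = Some u" "u \<le> v" for u
    using that world find_SomeD(1)[OF that(1)] permutations_of_setD(1)[OF ordering]
    by (simp add: world_le_world)
  then have "dirac_cond_prob l v b = of_bool (find (\<lambda>w. w \<le> b) l = Some v)"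
    by (auto simp: dirac_cond_prob_def)
  moreover have "filter (\<lambda>w. w \<le> b - v) l = filter (\<lambda>w. w \<le> b \<and> w \<noteq> v) l"
    using world permutations_of_setD(1)[OF ordering]
    by (intro filter_cong) (auto simp: world_le_diff)
  ultimately show ?case
    using Cons.IH[OF rest] permutations_of_setD(2)[OF ordering]
    by (simp add: filter_eq_Cons_iff_find)
qed

lemma draw_expect_dirac:
  fixes l :: "'a::{finite,boolean_algebra} list"
  assumes ordering: "l \<in> permutations_of_set worlds"
  shows "draw_expect (dirac_cond_prob l) b F = F (filter (\<lambda>w. w \<le> b) l)"
proof -
  have "filter (\<lambda>w. w \<le> b) l \<in> permutations_of_set (below b)"
    by (intro permutations_of_setI) (auto simp: permutations_of_setD[OF ordering])
  then show ?thesis by (simp add: draw_expect_def draw_prob_dirac[OF ordering])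
qed

lemma rv_dirac:
  fixes l :: "'a::{finite,boolean_algebra} list"
  assumes nontriv: "(bot :: 'a) \<noteq> top" and wf: "wf_cterm t"
    and ordering: "w # l \<in> permutations_of_set worlds"
  shows "rv (dirac_cond_prob (w # l)) t w = of_bool (holds (w # l) t)"
proof -
  have world: "w \<in> worlds" and set: "set (w # l) = worlds" and "w \<notin> set l"
    using ordering by (auto simp: permutations_of_set_def)
  then have "filter (\<lambda>v. v \<le> - w) (w # l) = l"
    by (auto simp: world_le_compl world_le_world intro!: filter_True)
  then show ?thesis
    using rv_eq_draw_expect[OF nontriv cond_prob_dirac[OF set] wf world]
      draw_expect_dirac[OF ordering]
    by simp
qed

section \<open>The conjunctions \<open>\<omega>\<close>\<close>

lemma holds_conj_list: "holds l (conj_list ts) \<longleftrightarrow> (\<forall>t\<in>set ts. holds l t)"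
  by (induction ts rule: conj_list.induct) auto

lemma wf_conj_list: "wf_cterm (conj_list ts) \<longleftrightarrow> (\<forall>t\<in>set ts. wf_cterm t)"
  by (induction ts rule: conj_list.induct) auto

lemma holds_omega_snoc:
  "holds l (omega (\<beta> @ [v])) \<longleftrightarrow> holds l (omega \<beta>) \<and> holds l (Cond v (inf_compls \<beta>))"
  by (auto simp: omega_def holds_conj_list nth_append simp del: holds.simps)

lemma wf_omega_snoc:
  "wf_cterm (omega (\<beta> @ [v])) \<longleftrightarrow> wf_cterm (omega \<beta>) \<and> inf_compls \<beta> \<noteq> bot"
  by (auto simp: omega_def wf_conj_list nth_append)

lemma world_le_inf_compls:
  "w \<in> worlds \<Longrightarrow> set \<beta> \<subseteq> worlds \<Longrightarrow> w \<le> inf_compls \<beta> \<longleftrightarrow> w \<notin> set \<beta>"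
  by (induction \<beta>) (auto simp: inf_compls_def world_le_compl world_le_world)

lemma wf_omega:
  "set \<beta> \<subseteq> worlds \<Longrightarrow> distinct \<beta> \<Longrightarrow> wf_cterm (omega \<beta>)"
proof (induction \<beta> rule: rev_induct)
  case (snoc v \<beta>)
  then have "v \<le> inf_compls \<beta>" "v \<in> worlds" by (simp_all add: world_le_inf_compls)
  then show ?case using snoc not_world_le_bot[of v] by (auto simp: wf_omega_snoc)
qed (simp add: omega_def)

lemma holds_append_Cond_inf_compls:
  assumes ordering: "\<beta> @ k \<in> permutations_of_set worlds" and world: "v \<in> worlds"
  shows "holds (\<beta> @ k) (Cond v (inf_compls \<beta>)) \<longleftrightarrow> prefix [v] k"
proof -
  have worlds: "set \<beta> \<subseteq> worlds" "set k \<subseteq> worlds" and disjoint: "set \<beta> \<inter> set k = {}"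
    using ordering by (auto simp: permutations_of_set_def)
  have "w \<le> inf_compls \<beta> \<longleftrightarrow> w \<notin> set \<beta>" if "w \<in> set (\<beta> @ k)" for w
    using that worlds by (intro world_le_inf_compls) auto
  then have "find (\<lambda>w. w \<le> inf_compls \<beta>) (\<beta> @ k) = find (\<lambda>w. w \<notin> set \<beta>) (\<beta> @ k)"
    by (intro find_cong refl)
  also have "\<dots> = find (\<lambda>w. w \<notin> set \<beta>) k"
    by (simp add: find_dropWhile)
  also have "\<dots> = (case k of [] \<Rightarrow> None | w # _ \<Rightarrow> Some w)"
    using disjoint by (auto split: list.split)
  finally show ?thesis
    using worlds world by (auto simp: world_le_world split: list.splits)
qed

lemma holds_omega_iff_prefix:
  assumes ordering: "l \<in> permutations_of_set worlds" and "set \<beta> \<subseteq> worlds"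
  shows "holds l (omega \<beta>) \<longleftrightarrow> prefix \<beta> l"
  using assms(2)
proof (induction \<beta> rule: rev_induct)
  case Nil
  show ?case by (simp add: omega_def)
next
  case (snoc v \<beta>)
  show ?case
  proof (cases "prefix \<beta> l")
    case True
    then obtain k where "l = \<beta> @ k" by (rule prefixE)
    then show ?thesis
      using snoc ordering holds_append_Cond_inf_compls[of \<beta> k v] by (simp add: holds_omega_snoc)
  next
    case False
    then show ?thesis using snoc by (auto simp: holds_omega_snoc dest: append_prefixD)
  qed
qed

lemma models_omega:
  assumes worlds: "set \<beta> \<subseteq> worlds" "distinct \<beta>" and rest: "worlds - set \<beta> = {v}"
  shows "models (omega \<beta>) = {\<beta> @ [v]}"
proof -
  have "\<beta> @ k \<in> permutations_of_set worlds \<longleftrightarrow> k \<in> permutations_of_set {v}" for k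
    using worlds by (auto simp: permutations_of_set_def simp flip: rest)
  then show ?thesis
    using worlds(1) by (auto simp: models_def holds_omega_iff_prefix prefix_def)
qed

lemma is_singleton_models_omega:
  fixes \<beta> :: "'a::{finite,boolean_algebra} list"
  assumes "set \<beta> \<subseteq> worlds" "distinct \<beta>" "Suc (length \<beta>) = card (worlds :: 'a set)"
  shows "is_singleton (models (omega \<beta>))"
proof -
  have "card (worlds - set \<beta>) = 1"
    using assms by (simp add: card_Diff_subset distinct_card flip: assms(3))
  then obtain v where "worlds - set \<beta> = {v}" by (rule card_1_singletonE)
  then show ?thesis using assms by (simp add: models_omega)
qed

lemma models_omega_eq_singletonE:
  fixes l :: "'a::boolean_algebra list"
  assumes ordering: "l \<in> permutations_of_set worlds" and "(worlds :: 'a set) \<noteq> {}"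
  obtains \<beta> where "set \<beta> \<subseteq> worlds" "distinct \<beta>" "Suc (length \<beta>) = card (worlds :: 'a set)"
    "models (omega \<beta>) = {l}"
proof -
  have "l \<noteq> []" using assms by (auto simp: permutations_of_set_def)
  then obtain \<beta> v where l_eq: "l = \<beta> @ [v]" by (cases l rule: rev_cases) auto
  then have "worlds - set \<beta> = {v}" "set \<beta> \<subseteq> worlds" "distinct \<beta>"
    using ordering by (auto simp: permutations_of_set_def)
  moreover have "Suc (length \<beta>) = card (worlds :: 'a set)"
    using length_finite_permutations_of_set[OF ordering] by (simp add: l_eq)
  ultimately show ?thesis by (intro that[of \<beta>]) (simp_all add: l_eq models_omega)
qed

section \<open>The algebra of conditionals\<close>

lemma ba_atoms_eq_singletons:
  assumes carrier: "ba_carrier B = g ` S"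
    and zero_iff: "\<And>s. s \<in> S \<Longrightarrow> g s = ba_zero B \<longleftrightarrow> f s = {}"
    and le_iff: "\<And>s t. s \<in> S \<Longrightarrow> t \<in> S \<Longrightarrow> ba_le B (g s) (g t) \<longleftrightarrow> f s \<subseteq> f t"
    and eq_iff: "\<And>s t. s \<in> S \<Longrightarrow> t \<in> S \<Longrightarrow> g s = g t \<longleftrightarrow> f s = f t"
    and singletons: "\<And>s x. s \<in> S \<Longrightarrow> x \<in> f s \<Longrightarrow> \<exists>t\<in>S. f t = {x}"
  shows "ba_atoms B = g ` {s \<in> S. is_singleton (f s)}"
proof -
  have "g s \<in> ba_atoms B \<longleftrightarrow> is_singleton (f s)" if mem: "s \<in> S" for s
  proof -
    have "g s \<in> ba_atoms B \<longleftrightarrow>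
        f s \<noteq> {} \<and> (\<forall>t\<in>S. f t \<subseteq> f s \<longrightarrow> f t = {} \<or> f t = f s)"
      using mem by (auto simp: ba_atoms_def carrier zero_iff le_iff eq_iff)
    also have "\<dots> \<longleftrightarrow> is_singleton (f s)"
    proof
      assume atom: "f s \<noteq> {} \<and> (\<forall>t\<in>S. f t \<subseteq> f s \<longrightarrow> f t = {} \<or> f t = f s)"
      then obtain x where "x \<in> f s" by blast
      moreover from this obtain t where "t \<in> S" "f t = {x}" using singletons[OF mem] by blast
      ultimately have "f s = {x}" using atom by fastforce
      then show "is_singleton (f s)" by simp
    qed (auto elim!: is_singletonE)
    finally show ?thesis .
  qed
  then show ?thesis by (auto simp: ba_atoms_def carrier)
qed

context
  assumes nontriv: "(bot :: 'a::{finite,boolean_algebra}) \<noteq> top"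
begin

lemma worlds_nonempty: "(worlds :: 'a set) \<noteq> {}"
  using below_nonempty[OF nontriv[symmetric]] by simp

lemma cond_equiv_iff_models:
  fixes t s :: "'a cterm"
  assumes wf: "wf_cterm t" "wf_cterm s"
  shows "(t, s) \<in> cond_equiv \<longleftrightarrow> models t = models s"
proof
  assume equiv: "(t, s) \<in> cond_equiv"
  have "holds l t \<longleftrightarrow> holds l s" if ordering: "l \<in> permutations_of_set worlds" for l :: "'a list"
  proof -
    have set: "set l = worlds" using ordering by (rule permutations_of_setD)
    then obtain w k where l_eq: "l = w # k" "w \<in> worlds"
      using worlds_nonempty by (cases l) auto
    then have "rv (dirac_cond_prob l) t w = rv (dirac_cond_prob l) s w"
      using equiv cond_prob_dirac[OF set] by (simp add: cond_equiv_def)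
    then show ?thesis
      using rv_dirac[OF nontriv] wf ordering by (simp add: l_eq(1) of_bool_eq_iff)
  qed
  then show "models t = models s" by (auto simp: models_def)
next
  assume models: "models t = models s"
  have "rv P t w = rv P s w" if prob: "cond_prob P" and world: "w \<in> worlds" for P w
  proof -
    have "holds (w # l) t \<longleftrightarrow> holds (w # l) s" if "l \<in> permutations_of_set (below (- w))" for l
    proof -
      have "w # l \<in> permutations_of_set worlds"
        using that world Cons_permutations_below_iff[of w l top] by (simp add: diff_eq)
      then show ?thesis using models by (auto simp: models_def)
    qed
    then show ?thesis
      using rv_eq_draw_expect[OF nontriv prob] wf world by (auto intro: draw_expect_cong)
  qed
  then show "(t, s) \<in> cond_equiv" using wf by (simp add: cond_equiv_def cterms_def)
qed

lemma cond_class_eq_iff_models: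
  fixes t s :: "'a cterm"
  assumes "wf_cterm t" "wf_cterm s"
  shows "cond_class t = cond_class s \<longleftrightarrow> models t = models s"
  using eq_equiv_class_iff[OF equiv_cond_equiv, of t s] assms
  by (simp add: cond_class_def cond_equiv_iff_models cterms_def)

lemma cond_class_eq_Collect:
  fixes t :: "'a cterm"
  assumes "wf_cterm t"
  shows "cond_class t = {s. wf_cterm s \<and> models s = models t}"
  using cond_equiv_iff_models[OF assms] by (auto simp: cond_class_def cond_equiv_def cterms_def)

lemma cond_algebra_meet:
  fixes t s :: "'a cterm"
  assumes "wf_cterm t" "wf_cterm s"
  shows "ba_meet cond_algebra (cond_class t) (cond_class s) = cond_class (Conj t s)"
proof -
  have "cond_class (Conj t' s') = cond_class (Conj t s)"
    if "t' \<in> cond_class t" "s' \<in> cond_class s" for t' s'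
    using that assms by (simp add: cond_class_eq_Collect)
  then have "(\<Union>t'\<in>cond_class t. \<Union>s'\<in>cond_class s. cond_class (Conj t' s')) =
      (\<Union>t'\<in>cond_class t. \<Union>s'\<in>cond_class s. cond_class (Conj t s))"
    by (intro SUP_cong refl)
  moreover have "cond_class t \<noteq> {}" "cond_class s \<noteq> {}"
    using assms by (auto simp: cond_class_eq_Collect)
  ultimately show ?thesis by (simp add: cond_algebra_def)
qed

lemma cond_algebra_le:
  fixes t s :: "'a cterm"
  assumes "wf_cterm t" "wf_cterm s"
  shows "ba_le cond_algebra (cond_class t) (cond_class s) \<longleftrightarrow> models t \<subseteq> models s"
  using assms by (auto simp: ba_le_def cond_algebra_meet cond_class_eq_iff_models)

lemma cond_class_eq_zero_iff:
  fixes t :: "'a cterm"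
  assumes "wf_cterm t"
  shows "cond_class t = ba_zero cond_algebra \<longleftrightarrow> models t = {}"
  using assms nontriv by (simp add: cond_algebra_def cond_class_eq_iff_models)

lemma cond_algebra_carrier:
  "ba_carrier (cond_algebra :: 'a cterm set bool_alg) = cond_class ` {t. wf_cterm t}"
  by (auto simp: cond_algebra_def quotient_def cond_class_def cterms_def)

lemma ba_atoms_cond_algebra:
  "ba_atoms (cond_algebra :: 'a cterm set bool_alg) =
    cond_class ` {t. wf_cterm t \<and> is_singleton (models t)}"
proof -
  have "\<exists>s\<in>{s. wf_cterm s}. models s = {l}" if "l \<in> models t" for l and t :: "'a cterm"
  proof -
    have "l \<in> permutations_of_set worlds" using that by (simp add: models_def)
    then show ?thesis using worlds_nonempty wf_omega by (elim models_omega_eq_singletonE) auto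
  qed
  then show ?thesis
    using ba_atoms_eq_singletons[OF cond_algebra_carrier, of models]
    by (simp add: cond_class_eq_zero_iff cond_algebra_le cond_class_eq_iff_models)
qed

end

theorem theorem6p1:
  fixes n :: nat
  assumes "(bot :: 'a::{finite,boolean_algebra}) \<noteq> top"
    and "card (worlds :: 'a set) = n"
  shows "ba_atoms (cond_algebra :: 'a cterm set bool_alg) =
    {cond_class (omega \<beta>) | \<beta>. set \<beta> \<subseteq> worlds \<and> distinct \<beta> \<and> length \<beta> = n - 1}"
proof -
  let ?B = "{\<beta> :: 'a list. set \<beta> \<subseteq> worlds \<and> distinct \<beta> \<and> Suc (length \<beta>) = card (worlds :: 'a set)}"
  have length_iff: "length \<beta> = n - 1 \<longleftrightarrow> Suc (length \<beta>) = card (worlds :: 'a set)" for \<beta> :: "'a list"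
    using worlds_nonempty[OF assms(1)] card_gt_0_iff[of "worlds :: 'a set"] assms(2) by auto
  have "cond_class t \<in> cond_class ` omega ` ?B"
    if wf: "wf_cterm t" and singleton: "is_singleton (models t)" for t
  proof -
    obtain l where models_t: "models t = {l}" using singleton by (rule is_singletonE)
    then have "l \<in> permutations_of_set worlds" by (auto simp: models_def)
    then obtain \<beta> where omega_beta: "\<beta> \<in> ?B" "models (omega \<beta>) = {l}"
      using worlds_nonempty[OF assms(1)] by (elim models_omega_eq_singletonE) auto
    then have "cond_class t = cond_class (omega \<beta>)"
      using wf models_t by (simp add: cond_class_eq_iff_models[OF assms(1)] wf_omega)
    then show ?thesis using omega_beta(1) by blast
  qed
  moreover have "wf_cterm (omega \<beta>)" "is_singleton (models (omega \<beta>))" if "\<beta> \<in> ?B" for \<beta>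
    using that by (simp_all add: wf_omega is_singleton_models_omega)
  ultimately have "cond_class ` {t. wf_cterm t \<and> is_singleton (models t)} = cond_class ` omega ` ?B"
    by blast
  then show ?thesis unfolding length_iff ba_atoms_cond_algebra[OF assms(1)] by auto
qed

end
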